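(* Let $\mathbb{P}=(R,G)$ be a skew partial field and let $C$ be a $\mathbb{P}$-chain group on a finite set $E$. Then: (1) $(C^\perp)^\perp=C$; (2) $C^\perp$ is a $\mathbb{P}^\circ$-chain group; (3) $M(C)^*=M(C^\perp)$, where $M(C)^*$ denotes the dual matroid of $M(C)$.
   Context: A skew partial field is a pair $\mathbb{P}=(R,G)$ where $R$ is a (not necessarily commutative) ring with identity and $G$ is a subgroup of the group of units $R^*$ with $-1\in G$. For a ring $S$ and finite set $E$, an $S$-chain group on $E$ is a subset $C\subseteq S^E$ containing $0$ and closed under componentwise addition and left scalar multiplication $(sf)_e=sf_e$. The support of a chain $c$ is $\|c\|=\{e: c_e\neq0\}$; $c$ is elementary if $c\neq0$ and no nonzero chain of $C$ has support strictly contained in $\|c\|$; $c$ is $G$-primitive if all its entries lie in $G\cup\{0\}$. A $\mathbb{P}$-chain group is an $R$-chain group in which every elementary chain equals $rc'$ for some $r\in R$ and some $G$-primitive chain $c'$ of the group. For a $\mathbb{P}$-chain group $C$, $M(C)$ denotes the matroid on $E$ whose cocircuits are the supports of the elementary chains of $C$. The opposite ring $R^\circ$ has the same set, addition, $0,1$ as $R$ and multiplication $p\circ q:=q\cdot p$. The opposite skew partial field is $\mathbb{P}^\circ=(R^\circ,G^\circ)$, where $G^\circ$ is the subgroup of $(R^\circ)^*$ generated by the elements of $G$. For $C\subseteq R^E$, $C^\perp:=\{d\in R^E: \sum_{e}c_ed_e=0 \text{ for all } c\in C\}$ (products in $R$); this is an $R^\circ$-chain group. Accordingly $(C^\perp)^\perp$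 is formed in $R^\circ$: $(C^\perp)^\perp=\{x\in R^E: \sum_e d_e\circ x_e=0 \text{ for all } d\in C^\perp\}$.
   Formalization: The ring R is assumed to be nonzero (1 ≠ 0); over the zero ring part (3) fails for nonempty E, since C and its orthogonal complement are both {0} and both matroids have rank 0. *)

theory Defs
  imports "HOL-Algebra.Ring" "HOL-Algebra.Generated_Groups"
begin

section \<open>Finite matroids\<close>

record 'e matroid =
  ground :: "'e set"
  indeps :: "'e set set"

definition is_matroid :: "'e matroid \<Rightarrow> bool" where
  "is_matroid M \<longleftrightarrow>
     finite (ground M) \<and> indeps M \<subseteq> Pow (ground M) \<and> {} \<in> indeps M \<and>
     (\<forall>I\<in>indeps M. \<forall>J. J \<subseteq> I \<longrightarrow> J \<in> indeps M) \<and>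
     (\<forall>I\<in>indeps M. \<forall>J\<in>indeps M. card I < card J \<longrightarrow> (\<exists>x\<in>J - I. insert x I \<in> indeps M))"

definition bases :: "'e matroid \<Rightarrow> 'e set set" where
  "bases M = {B \<in> indeps M. \<forall>I\<in>indeps M. B \<subseteq> I \<longrightarrow> I = B}"

definition dual_matroid :: "'e matroid \<Rightarrow> 'e matroid" where
  "dual_matroid M = \<lparr>ground = ground M, indeps = {I. \<exists>B\<in>bases M. I \<subseteq> ground M - B}\<rparr>"

definition circuits :: "'e matroid \<Rightarrow> 'e set set" where
  "circuits M = {X. X \<subseteq> ground M \<and> X \<notin> indeps M \<and> (\<forall>Y. Y \<subset> X \<longrightarrow> Y \<in> indeps M)}"

definition cocircuits :: "'e matroid \<Rightarrow> 'e set set" where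
  "cocircuits M = circuits (dual_matroid M)"

section \<open>Skew partial fields and chain groups\<close>

text \<open>
  The zero ring has to be excluded: over it every chain is 0, so that no chain group has
  elementary chains, and duality of the associated matroids fails on a nonempty ground set.
\<close>

definition skew_partial_field :: "('r, 'm) ring_scheme \<Rightarrow> 'r set \<Rightarrow> bool" where
  "skew_partial_field R G \<longleftrightarrow>
     ring R \<and> \<one>\<^bsub>R\<^esub> \<noteq> \<zero>\<^bsub>R\<^esub> \<and> subgroup G (units_of R) \<and> \<ominus>\<^bsub>R\<^esub> \<one>\<^bsub>R\<^esub> \<in> G"

definition opposite_ring :: "('r, 'm) ring_scheme \<Rightarrow> ('r, 'm) ring_scheme" where
  "opposite_ring R = R\<lparr>mult := \<lambda>p q. q \<otimes>\<^bsub>R\<^esub> p\<rparr>"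

definition opposite_group :: "('r, 'm) ring_scheme \<Rightarrow> 'r set \<Rightarrow> 'r set" where
  "opposite_group R G = generate (units_of (opposite_ring R)) G"

text \<open>
  Chains on \<open>E\<close> are the extensional functions in \<open>E \<rightarrow>\<^sub>E carrier R\<close>, so that equality of chains
  is equality of functions.
\<close>

definition zero_chain :: "('r, 'm) ring_scheme \<Rightarrow> 'e set \<Rightarrow> 'e \<Rightarrow> 'r" where
  "zero_chain R E = (\<lambda>e\<in>E. \<zero>\<^bsub>R\<^esub>)"

definition add_chain :: "('r, 'm) ring_scheme \<Rightarrow> 'e set \<Rightarrow> ('e \<Rightarrow> 'r) \<Rightarrow> ('e \<Rightarrow> 'r) \<Rightarrow> 'e \<Rightarrow> 'r" where
  "add_chain R E c d = (\<lambda>e\<in>E. c e \<oplus>\<^bsub>R\<^esub> d e)"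

definition scale_chain :: "('r, 'm) ring_scheme \<Rightarrow> 'e set \<Rightarrow> 'r \<Rightarrow> ('e \<Rightarrow> 'r) \<Rightarrow> 'e \<Rightarrow> 'r" where
  "scale_chain R E r c = (\<lambda>e\<in>E. r \<otimes>\<^bsub>R\<^esub> c e)"

definition chain_group :: "('r, 'm) ring_scheme \<Rightarrow> 'e set \<Rightarrow> ('e \<Rightarrow> 'r) set \<Rightarrow> bool" where
  "chain_group R E C \<longleftrightarrow>
     C \<subseteq> (E \<rightarrow>\<^sub>E carrier R) \<and> zero_chain R E \<in> C \<and>
     (\<forall>c\<in>C. \<forall>d\<in>C. add_chain R E c d \<in> C) \<and>
     (\<forall>r\<in>carrier R. \<forall>c\<in>C. scale_chain R E r c \<in> C)"

definition chain_support :: "('r, 'm) ring_scheme \<Rightarrow> 'e set \<Rightarrow> ('e \<Rightarrow> 'r) \<Rightarrow> 'e set" where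
  "chain_support R E c = {e \<in> E. c e \<noteq> \<zero>\<^bsub>R\<^esub>}"

definition elementary_chain ::
    "('r, 'm) ring_scheme \<Rightarrow> 'e set \<Rightarrow> ('e \<Rightarrow> 'r) set \<Rightarrow> ('e \<Rightarrow> 'r) \<Rightarrow> bool" where
  "elementary_chain R E C c \<longleftrightarrow>
     c \<in> C \<and> c \<noteq> zero_chain R E \<and>
     \<not> (\<exists>d\<in>C. d \<noteq> zero_chain R E \<and> chain_support R E d \<subset> chain_support R E c)"

definition primitive_chain ::
    "('r, 'm) ring_scheme \<Rightarrow> 'r set \<Rightarrow> 'e set \<Rightarrow> ('e \<Rightarrow> 'r) \<Rightarrow> bool" where
  "primitive_chain R G E c \<longleftrightarrow> (\<forall>e\<in>E. c e \<in> G \<union> {\<zero>\<^bsub>R\<^esub>})"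

definition pf_chain_group ::
    "('r, 'm) ring_scheme \<Rightarrow> 'r set \<Rightarrow> 'e set \<Rightarrow> ('e \<Rightarrow> 'r) set \<Rightarrow> bool" where
  "pf_chain_group R G E C \<longleftrightarrow>
     chain_group R E C \<and>
     (\<forall>c. elementary_chain R E C c \<longrightarrow>
        (\<exists>r\<in>carrier R. \<exists>c'\<in>C. primitive_chain R G E c' \<and> c = scale_chain R E r c'))"

definition perp :: "('r, 'm) ring_scheme \<Rightarrow> 'e set \<Rightarrow> ('e \<Rightarrow> 'r) set \<Rightarrow> ('e \<Rightarrow> 'r) set" where
  "perp R E C =
     {d \<in> E \<rightarrow>\<^sub>E carrier R. \<forall>c\<in>C. (\<Oplus>\<^bsub>R\<^esub>e\<in>E. c e \<otimes>\<^bsub>R\<^esub> d e) = \<zero>\<^bsub>R\<^esub>}"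

definition elementary_supports ::
    "('r, 'm) ring_scheme \<Rightarrow> 'e set \<Rightarrow> ('e \<Rightarrow> 'r) set \<Rightarrow> 'e set set" where
  "elementary_supports R E C = {chain_support R E c | c. elementary_chain R E C c}"

text \<open>
  That this description denotes for chain groups over a skew partial field is shown in
  \<open>chain_matroid_unique\<close> below.
\<close>

definition chain_matroid ::
    "('r, 'm) ring_scheme \<Rightarrow> 'e set \<Rightarrow> ('e \<Rightarrow> 'r) set \<Rightarrow> 'e matroid" where
  "chain_matroid R E C =
     (THE M. is_matroid M \<and> ground M = E \<and> cocircuits M = elementary_supports R E C)"

section \<open>The definitions are well posed\<close>

lemma ring_opposite:
  fixes R (structure)
  assumes "ring R" shows "ring (opposite_ring R)"
proof -
  interpret ring R by fact
  show ?thesis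
    by (rule ringI; (rule abelian_groupI monoidI)?)
      (auto simp: opposite_ring_def a_ac m_assoc l_distr r_distr intro: l_neg)
qed

lemma skew_partial_field_opposite:
  fixes R (structure)
  assumes P: "skew_partial_field R G"
  shows "skew_partial_field (opposite_ring R) (opposite_group R G)"
proof -
  interpret ring R using P by (simp add: skew_partial_field_def)
  interpret o: ring "opposite_ring R" by (rule ring_opposite) (rule ring_axioms)
  have "Units (opposite_ring R) = Units R"
    by (auto simp: Units_def opposite_ring_def)
  moreover have "G \<subseteq> Units R"
    using P subgroup.subset unfolding skew_partial_field_def by (metis units_of_carrier)
  ultimately have "subgroup (opposite_group R G) (units_of (opposite_ring R))"
    unfolding opposite_group_def
    by (intro group.generate_is_subgroup o.units_group) (simp add: units_of_carrier)
  moreover have "\<ominus>\<^bsub>opposite_ring R\<^esub> \<one>\<^bsub>opposite_ring R\<^esub> = \<ominus> \<one>"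
    by (simp add: a_inv_def m_inv_def opposite_ring_def)
  moreover have "\<ominus> \<one> \<in> opposite_group R G"
    using P unfolding skew_partial_field_def opposite_group_def by (auto intro: generate.incl)
  moreover have "\<one>\<^bsub>opposite_ring R\<^esub> \<noteq> \<zero>\<^bsub>opposite_ring R\<^esub>"
    using P by (simp add: skew_partial_field_def opposite_ring_def)
  ultimately show ?thesis using o.ring_axioms by (simp add: skew_partial_field_def)
qed

lemma matroid_indepD:
  assumes "is_matroid M" "I \<in> indeps M"
  shows "I \<subseteq> ground M" "finite I"
proof -
  show "I \<subseteq> ground M" using assms by (auto simp: is_matroid_def)
  then show "finite I" using assms(1) finite_subset by (auto simp: is_matroid_def)
qed

lemma bases_subset: "is_matroid M \<Longrightarrow> B \<in> bases M \<Longrightarrow> B \<subseteq> ground M"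
  by (rule matroid_indepD(1)) (simp_all add: bases_def)

lemma matroid_extend:
  assumes M: "is_matroid M" and I: "I \<in> indeps M" and B: "B \<in> bases M"
  shows "\<exists>B'\<in>bases M. I \<subseteq> B' \<and> B' \<subseteq> I \<union> B"
proof -
  let ?S = "{J \<in> indeps M. I \<subseteq> J \<and> J \<subseteq> I \<union> B}"
  have fin: "finite (ground M)" and sub: "indeps M \<subseteq> Pow (ground M)"
    using M by (auto simp: is_matroid_def)
  have aug: "\<exists>x\<in>J - I. insert x I \<in> indeps M"
    if "I \<in> indeps M" "J \<in> indeps M" "card I < card J" for I J
    using M that unfolding is_matroid_def by blast
  have finI: "finite J" if "J \<in> indeps M" for J
    using matroid_indepD(2)[OF M that] .
  have "finite ?S"
    by (rule finite_subset[of _ "Pow (ground M)"]) (use fin sub in auto)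
  moreover have "?S \<noteq> {}" using I by auto
  ultimately have "\<exists>J\<in>?S. \<forall>K\<in>?S. J \<subseteq> K \<longrightarrow> J = K" by (rule finite_has_maximal)
  then obtain J where J: "J \<in> ?S" and mx: "\<forall>K\<in>?S. J \<subseteq> K \<longrightarrow> J = K"
    by (rule bexE)
  have Bi: "B \<in> indeps M" using B by (simp add: bases_def)
  have BJ: "card B \<le> card J"
  proof (rule ccontr)
    assume "\<not> ?thesis"
    then obtain x where "x \<in> B - J" "insert x J \<in> indeps M"
      using aug[of J B] J Bi by auto
    then have "insert x J \<in> ?S" "J \<noteq> insert x J" using J by auto
    then show False using bspec[OF mx, of "insert x J"] by (simp add: subset_insertI)
  qed
  have "K = J" if K: "K \<in> indeps M" "J \<subseteq> K" for K
  proof (rule ccontr)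
    assume "K \<noteq> J"
    then have "card J < card K" using K finI by (simp add: psubset_card_mono psubsetI)
    then obtain x where "x \<in> K - B" "insert x B \<in> indeps M"
      using aug[of B K] BJ Bi K by auto
    then show False using B unfolding bases_def by blast
  qed
  then have "J \<in> bases M" using J by (simp add: bases_def)
  then show ?thesis using J by blast
qed

lemma bases_ne: assumes "is_matroid M" shows "bases M \<noteq> {}"
proof -
  have "finite (indeps M)" "indeps M \<noteq> {}"
    using assms unfolding is_matroid_def by (auto intro: finite_subset[of _ "Pow (ground M)"])
  then obtain B where "B \<in> indeps M" "\<And>K. K \<in> indeps M \<Longrightarrow> B \<subseteq> K \<Longrightarrow> K = B"
    using finite_has_maximal[of "indeps M"] by metis
  then show ?thesis unfolding bases_def by blast
qed

lemma indeps_iff: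
  assumes "is_matroid M" shows "I \<in> indeps M \<longleftrightarrow> (\<exists>B\<in>bases M. I \<subseteq> B)"
proof
  assume "I \<in> indeps M"
  then show "\<exists>B\<in>bases M. I \<subseteq> B"
    using matroid_extend[OF assms] bases_ne[OF assms] by blast
next
  assume "\<exists>B\<in>bases M. I \<subseteq> B"
  then show "I \<in> indeps M" using assms unfolding is_matroid_def bases_def by blast
qed

lemma bases_card_le:
  assumes M: "is_matroid M" and I: "I \<in> indeps M" and B: "B \<in> bases M"
  shows "card I \<le> card B"
proof (rule ccontr)
  assume "\<not> ?thesis"
  moreover have "B \<in> indeps M" using B by (simp add: bases_def)
  ultimately obtain x where "x \<in> I - B" "insert x B \<in> indeps M"
    using M I unfolding is_matroid_def by (meson not_le)
  then show False using B unfolding bases_def by blast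
qed

lemma is_matroid_dual:
  assumes M: "is_matroid M" shows "is_matroid (dual_matroid M)"
proof -
  let ?E = "ground M"
  have fin: "finite ?E" and sub: "indeps M \<subseteq> Pow ?E"
    using M by (auto simp: is_matroid_def)
  have fins: "finite X" if "X \<subseteq> ?E" for X using that fin finite_subset by blast
  have aug: "\<exists>x\<in>J - I. \<exists>B\<in>bases M. insert x I \<subseteq> ?E - B"
    if BI: "BI \<in> bases M" "I \<subseteq> ?E - BI" and BJ: "BJ \<in> bases M" "J \<subseteq> ?E - BJ"
      and lt: "card I < card J" for I J BI BJ
  proof -
    have BJi: "BJ \<in> indeps M" and BJE: "BJ \<subseteq> ?E" using BJ sub by (auto simp: bases_def)
    then have "BJ - I \<in> indeps M" using M unfolding is_matroid_def by (meson Diff_subset)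
    then obtain B' where B': "B' \<in> bases M" "BJ - I \<subseteq> B'" "B' \<subseteq> (BJ - I) \<union> BI"
      using matroid_extend[OF M _ BI(1)] by blast
    have B'i: "B' \<in> indeps M" using B' by (simp add: bases_def)
    have disj: "B' \<inter> I = {}" using B' BI by blast
    have "\<not> J - I \<subseteq> B'"
    proof
      assume le: "J - I \<subseteq> B'"
      have fI: "finite I" "finite J" "finite BJ" "finite B'"
        using BI BJ BJE B'i sub by (auto intro: fins)
      have "card (I - J) < card (J - I)"
        using lt fI by (simp add: card_less_sym_Diff)
      moreover have "card (BJ \<inter> I) \<le> card (I - J)"
        using BJ fI by (intro card_mono) auto
      moreover have "card BJ = card (BJ - I) + card (BJ \<inter> I)"
        using fI by (metis card_Int_Diff add.commute)
      moreover have "card ((BJ - I) \<union> (J - I)) = card (BJ - I) + card (J - I)"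
        using BJ fI by (intro card_Un_disjoint) auto
      moreover have "card ((BJ - I) \<union> (J - I)) \<le> card B'"
        using le B' fI by (intro card_mono) auto
      moreover have "card B' \<le> card BJ" using bases_card_le[OF M B'i BJ(1)] .
      ultimately show False by linarith
    qed
    then obtain x where x: "x \<in> J - I" "x \<notin> B'" by blast
    then have "insert x I \<subseteq> ?E - B'" using disj BI BJ by blast
    then show ?thesis using x B' by blast
  qed
  have "J \<in> indeps (dual_matroid M)" if "I \<in> indeps (dual_matroid M)" "J \<subseteq> I" for I J
    using that unfolding dual_matroid_def by auto
  moreover have "\<exists>x\<in>J - I. insert x I \<in> indeps (dual_matroid M)"
    if IJ: "I \<in> indeps (dual_matroid M)" "J \<in> indeps (dual_matroid M)" "card I < card J" for I J
  proof -
    obtain BI BJ where "BI \<in> bases M" "I \<subseteq> ?E - BI" "BJ \<in> bases M" "J \<subseteq> ?E - BJ"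
      using IJ(1,2) unfolding dual_matroid_def by (simp, blast)
    from aug[OF this IJ(3)] show ?thesis by (simp add: dual_matroid_def)
  qed
  moreover have "{} \<in> indeps (dual_matroid M)" using bases_ne[OF M]
    by (auto simp: dual_matroid_def)
  moreover have "ground (dual_matroid M) = ?E" "indeps (dual_matroid M) \<subseteq> Pow ?E"
    by (auto simp: dual_matroid_def)
  ultimately show ?thesis using fin unfolding is_matroid_def by simp
qed

lemma ground_dual [simp]: "ground (dual_matroid M) = ground M"
  by (simp add: dual_matroid_def)

lemma bases_dual:
  assumes M: "is_matroid M" shows "bases (dual_matroid M) = (\<lambda>B. ground M - B) ` bases M"
proof -
  have sub: "B \<subseteq> ground M" if "B \<in> bases M" for B
    using bases_subset[OF M that] .
  have incomp: "B = B'" if "B \<in> bases M" "B' \<in> bases M" "B \<subseteq> B'" for B B'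
    using that unfolding bases_def by auto
  have ind: "I \<in> indeps (dual_matroid M) \<longleftrightarrow> (\<exists>B\<in>bases M. I \<subseteq> ground M - B)" for I
    by (simp add: dual_matroid_def)
  show ?thesis
  proof (rule Set.set_eqI, rule iffI)
    fix X assume X: "X \<in> bases (dual_matroid M)"
    then obtain B where B: "B \<in> bases M" "X \<subseteq> ground M - B"
      unfolding bases_def[of "dual_matroid M"] ind by auto
    then have "ground M - B \<in> indeps (dual_matroid M)" unfolding ind by blast
    then have "ground M - B = X" using X B unfolding bases_def[of "dual_matroid M"] by blast
    then show "X \<in> (\<lambda>B. ground M - B) ` bases M" using B by blast
  next
    fix X assume "X \<in> (\<lambda>B. ground M - B) ` bases M"
    then obtain B where B: "B \<in> bases M" "X = ground M - B" by blast
    have "I = X" if I: "I \<in> indeps (dual_matroid M)" "X \<subseteq> I" for I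
    proof -
      obtain B' where B': "B' \<in> bases M" "I \<subseteq> ground M - B'" using I ind by blast
      then have "B' \<subseteq> B" using I B sub[of B'] by blast
      then have "B' = B" using incomp B B' by blast
      then show ?thesis using B B' I by blast
    qed
    moreover have "X \<in> indeps (dual_matroid M)" using B ind by blast
    ultimately show "X \<in> bases (dual_matroid M)"
      unfolding bases_def[of "dual_matroid M"] by blast
  qed
qed

lemma dual_dual_matroid:
  assumes M: "is_matroid M" shows "dual_matroid (dual_matroid M) = M"
proof -
  have sub: "B \<subseteq> ground M" if "B \<in> bases M" for B
    using bases_subset[OF M that] .
  have "indeps (dual_matroid (dual_matroid M)) = {I. \<exists>B\<in>bases M. I \<subseteq> ground M - (ground M - B)}"
    unfolding dual_matroid_def[of "dual_matroid M"] by (simp add: bases_dual[OF M])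
  also have "\<dots> = {I. \<exists>B\<in>bases M. I \<subseteq> B}"
    using sub by (simp add: double_diff cong: bex_cong)
  also have "\<dots> = indeps M" using indeps_iff[OF M] by blast
  finally show ?thesis by (intro matroid.equality) simp_all
qed

lemma indeps_circuits:
  assumes M: "is_matroid M"
  shows "indeps M = {I. I \<subseteq> ground M \<and> (\<forall>X\<in>circuits M. \<not> X \<subseteq> I)}"
proof (rule Set.set_eqI, rule iffI)
  fix I assume "I \<in> indeps M"
  then show "I \<in> {I. I \<subseteq> ground M \<and> (\<forall>X\<in>circuits M. \<not> X \<subseteq> I)}"
    using M unfolding is_matroid_def circuits_def by blast
next
  fix I assume I: "I \<in> {I. I \<subseteq> ground M \<and> (\<forall>X\<in>circuits M. \<not> X \<subseteq> I)}"
  show "I \<in> indeps M"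
  proof (rule ccontr)
    assume "I \<notin> indeps M"
    moreover have "finite I" using I M unfolding is_matroid_def by (auto intro: finite_subset)
    ultimately have "finite {X. X \<subseteq> I \<and> X \<notin> indeps M}" "{X. X \<subseteq> I \<and> X \<notin> indeps M} \<noteq> {}"
      by auto
    from finite_has_minimal[OF this] obtain X where X: "X \<subseteq> I" "X \<notin> indeps M"
        and mn: "\<forall>Y\<in>{X. X \<subseteq> I \<and> X \<notin> indeps M}. Y \<subseteq> X \<longrightarrow> X = Y"
      by (rule bexE) (drule CollectD, blast)
    have "Y \<in> indeps M" if "Y \<subset> X" for Y
    proof (rule ccontr)
      assume "Y \<notin> indeps M"
      then have "Y \<in> {X. X \<subseteq> I \<and> X \<notin> indeps M}" using that X by auto
      then show False using bspec[OF mn] that by blast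
    qed
    then have "X \<in> circuits M" using I X unfolding circuits_def by auto
    then show False using I X by blast
  qed
qed

lemma matroid_eqI_cocircuits:
  assumes "is_matroid M" "is_matroid N" "ground M = ground N" "cocircuits M = cocircuits N"
  shows "M = N"
proof -
  have "indeps (dual_matroid M) = indeps (dual_matroid N)"
    using assms by (simp add: indeps_circuits is_matroid_dual cocircuits_def)
  then have "dual_matroid M = dual_matroid N" using assms by (intro matroid.equality) simp_all
  then show ?thesis using assms dual_dual_matroid by metis
qed

lemma matroid_of_circuits:
  assumes fin: "finite E" and sub: "D \<subseteq> Pow E" and ne: "{} \<notin> D"
    and anti: "\<And>X Y. X \<in> D \<Longrightarrow> Y \<in> D \<Longrightarrow> X \<subseteq> Y \<Longrightarrow> X = Y"
    and elim: "\<And>X Y e. X \<in> D \<Longrightarrow> Y \<in> D \<Longrightarrow> X \<noteq> Y \<Longrightarrow> e \<in> X \<Longrightarrow> e \<in> Y \<Longrightarrow>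
                 \<exists>Z\<in>D. Z \<subseteq> (X \<union> Y) - {e}"
  shows "\<exists>M. is_matroid M \<and> ground M = E \<and> circuits M = D"
proof -
  define F where "F = {I. I \<subseteq> E \<and> (\<forall>X\<in>D. \<not> X \<subseteq> I)}"
  have her: "J \<in> F" if "I \<in> F" "J \<subseteq> I" for I J using that unfolding F_def by blast
  have aug: "\<exists>x\<in>J - I. insert x I \<in> F" if IJ: "I \<in> F" "J \<in> F" "card I < card J" for I J
  proof (rule ccontr)
    assume no: "\<not> ?thesis"
    let ?P = "\<lambda>K. K \<in> F \<and> K \<subseteq> I \<union> J \<and> card I < card K"
    have "?P J" using IJ by auto
    from ex_has_least_nat[of ?P, OF this, of "\<lambda>K. card (I - K)"]
    obtain K where "?P K \<and> (\<forall>L. ?P L \<longrightarrow> card (I - K) \<le> card (I - L))"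
      by (rule exE)
    then have K: "?P K" and mn: "\<And>L. ?P L \<Longrightarrow> card (I - K) \<le> card (I - L)"
      by (rule conjunct1, simp)
    have "I \<subseteq> E" "K \<subseteq> E" using IJ(1) conjunct1[OF K] unfolding F_def by simp_all
    then have finI: "finite I" and finK: "finite K"
      using finite_subset[OF _ fin] by simp_all
    have "\<not> K \<subseteq> I" using conjunct2[OF conjunct2[OF K]] card_mono[OF finI, of K] by auto
    then obtain g where g: "g \<in> K - I" by blast
    have "\<not> I \<subseteq> K"
    proof
      assume "I \<subseteq> K"
      then have "insert g I \<in> F" using her[of K "insert g I"] K g by simp
      moreover have "g \<in> J - I" using g conjunct1[OF conjunct2[OF K]] by blast
      ultimately show False using no by blast
    qed
    then obtain e where e: "e \<in> I - K" by blast
    have dep: "\<exists>X\<in>D. X \<subseteq> insert e K - {f} \<and> e \<in> X" if f: "f \<in> K - I" for f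
    proof -
      let ?T = "insert e K - {f}"
      have "card ?T = card K" using f e finK by (simp add: card_Diff_singleton_if)
      moreover have "card (I - ?T) < card (I - K)"
        using e f finI by (intro psubset_card_mono) auto
      moreover have "?T \<subseteq> I \<union> J" using K e by blast
      ultimately have "?T \<notin> F" using mn[of ?T] K by auto
      moreover have "?T \<subseteq> E" using K e IJ unfolding F_def by blast
      ultimately obtain X where X: "X \<in> D" "X \<subseteq> ?T" unfolding F_def by blast
      moreover have "e \<in> X" using X K unfolding F_def by blast
      ultimately show ?thesis by blast
    qed
    obtain X where X: "X \<in> D" "X \<subseteq> insert e K - {g}" "e \<in> X" using dep[OF g] by blast
    have "\<not> X \<subseteq> I" using X IJ unfolding F_def by blast
    then obtain h where h: "h \<in> X" "h \<in> K - I" using X e by blast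
    obtain Y where Y: "Y \<in> D" "Y \<subseteq> insert e K - {h}" "e \<in> Y" using dep[OF h(2)] by blast
    have "X \<noteq> Y" using h Y by blast
    then obtain Z where "Z \<in> D" "Z \<subseteq> (X \<union> Y) - {e}" using elim X Y by metis
    then have "Z \<in> D" "Z \<subseteq> K" using X Y by auto
    then show False using K unfolding F_def by blast
  qed
  define M where "M = \<lparr>ground = E, indeps = F\<rparr>"
  have "{} \<in> F" "F \<subseteq> Pow E" using ne unfolding F_def by auto
  then have "is_matroid M" using fin her aug unfolding is_matroid_def M_def by simp
  moreover have "circuits M = D"
  proof (rule Set.set_eqI, rule iffI)
    fix X assume "X \<in> circuits M"
    then have X: "X \<subseteq> E" "X \<notin> F" "\<And>Y. Y \<subset> X \<Longrightarrow> Y \<in> F" by (auto simp: circuits_def M_def)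
    then obtain Y where Y: "Y \<in> D" "Y \<subseteq> X" unfolding F_def by blast
    then have "Y \<notin> F" unfolding F_def by blast
    then have "Y = X" using X(3)[of Y] Y(2) by blast
    then show "X \<in> D" using Y(1) by simp
  next
    fix X assume X: "X \<in> D"
    have "Y \<in> F" if "Y \<subset> X" for Y
    proof -
      have "\<not> Z \<subseteq> Y" if "Z \<in> D" for Z using anti[OF that X] \<open>Y \<subset> X\<close> by blast
      then show ?thesis using that X sub unfolding F_def by blast
    qed
    moreover have "X \<notin> F" "X \<subseteq> E" using X sub unfolding F_def by auto
    ultimately show "X \<in> circuits M" by (simp add: circuits_def M_def)
  qed
  ultimately show ?thesis by (intro exI[of _ M]) (simp add: M_def)
qed

lemma support_empty_iff:
  assumes "c \<in> E \<rightarrow>\<^sub>E carrier R"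
  shows "chain_support R E c = {} \<longleftrightarrow> c = zero_chain R E"
proof
  assume "chain_support R E c = {}"
  then have "c e = zero_chain R E e" for e
    using PiE_arb[OF assms, of e] by (auto simp: chain_support_def zero_chain_def)
  then show "c = zero_chain R E" by (rule ext)
qed (simp add: chain_support_def zero_chain_def)

lemma elementary_below:
  assumes fin: "finite E" and C: "chain_group R E C" and c: "c \<in> C" "c \<noteq> zero_chain R E"
  shows "\<exists>d. elementary_chain R E C d \<and> chain_support R E d \<subseteq> chain_support R E c"
proof -
  let ?P = "\<lambda>d. d \<in> C \<and> d \<noteq> zero_chain R E \<and> chain_support R E d \<subseteq> chain_support R E c"
  have "?P c" using c by auto
  from ex_has_least_nat[of ?P, OF this, of "\<lambda>d. card (chain_support R E d)"]
  obtain d where "?P d \<and> (\<forall>x. ?P x \<longrightarrow> card (chain_support R E d) \<le> card (chain_support R E x))"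
    by (rule exE)
  then have d: "?P d"
      and mn: "\<And>x. ?P x \<Longrightarrow> card (chain_support R E d) \<le> card (chain_support R E x)"
    by (rule conjunct1, simp)
  have "elementary_chain R E C d"
    unfolding elementary_chain_def
  proof (intro conjI notI)
    assume "\<exists>x\<in>C. x \<noteq> zero_chain R E \<and> chain_support R E x \<subset> chain_support R E d"
    then obtain x where x: "x \<in> C" "x \<noteq> zero_chain R E"
      "chain_support R E x \<subset> chain_support R E d" by blast
    have "finite (chain_support R E d)" using fin by (simp add: chain_support_def)
    then have "card (chain_support R E x) < card (chain_support R E d)"
      using x by (intro psubset_card_mono) auto
    moreover have "?P x" using x d by blast
    ultimately show False using mn by fastforce
  qed (use d in auto)
  then show ?thesis using d by blast
qed

lemma primitive_rep:
  fixes R (structure)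
  assumes P: "skew_partial_field R G" and C: "pf_chain_group R G E C"
    and c: "elementary_chain R E C c"
  shows "\<exists>c'\<in>C. primitive_chain R G E c' \<and> chain_support R E c' = chain_support R E c"
proof -
  interpret ring R using P by (simp add: skew_partial_field_def)
  obtain r c' where r: "r \<in> carrier R" "c' \<in> C" "primitive_chain R G E c'"
      "c = scale_chain R E r c'"
    using C c unfolding pf_chain_group_def by blast
  have GU: "G \<subseteq> Units R"
    using P subgroup.subset unfolding skew_partial_field_def by (metis units_of_carrier)
  have cC: "c \<in> E \<rightarrow>\<^sub>E carrier R" "c \<noteq> zero_chain R E"
    using C c unfolding pf_chain_group_def chain_group_def elementary_chain_def by auto
  have c'c: "c' \<in> E \<rightarrow>\<^sub>E carrier R"
    using C r unfolding pf_chain_group_def chain_group_def by auto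
  have r0: "r \<noteq> \<zero>"
  proof
    assume "r = \<zero>"
    have "scale_chain R E \<zero> c' = zero_chain R E"
      unfolding scale_chain_def zero_chain_def
      by (rule restrict_ext) (rule l_null[OF PiE_mem[OF c'c]])
    then have "c = zero_chain R E" using r(4) \<open>r = \<zero>\<close> by simp
    then show False using cC by simp
  qed
  have "c' e \<noteq> \<zero> \<longleftrightarrow> r \<otimes> c' e \<noteq> \<zero>" if "e \<in> E" for e
  proof
    assume "c' e \<noteq> \<zero>"
    then have u: "c' e \<in> Units R" using r that GU unfolding primitive_chain_def by blast
    show "r \<otimes> c' e \<noteq> \<zero>"
    proof
      assume "r \<otimes> c' e = \<zero>"
      then have "r \<otimes> c' e \<otimes> inv c' e = \<zero>" using u by simp
      then show False using u r r0 by (simp add: m_assoc Units_closed)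
    qed
  qed (use r in auto)
  then have "chain_support R E c' = chain_support R E c"
    unfolding r(4) by (auto simp: chain_support_def scale_chain_def)
  then show ?thesis using r by blast
qed

lemma elementary_supports_elim:
  fixes R (structure)
  assumes fin: "finite E" and P: "skew_partial_field R G" and C: "pf_chain_group R G E C"
    and XY: "X \<in> elementary_supports R E C" "Y \<in> elementary_supports R E C" "X \<noteq> Y"
    and e: "e \<in> X" "e \<in> Y"
  shows "\<exists>Z\<in>elementary_supports R E C. Z \<subseteq> (X \<union> Y) - {e}"
proof -
  interpret ring R using P by (simp add: skew_partial_field_def)
  have cg: "chain_group R E C" using C by (simp add: pf_chain_group_def)
  have GU: "G \<subseteq> Units R"
    using P subgroup.subset unfolding skew_partial_field_def by (metis units_of_carrier)
  obtain cx cy where el: "elementary_chain R E C cx" "X = chain_support R E cx"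
      "elementary_chain R E C cy" "Y = chain_support R E cy"
    using XY unfolding elementary_supports_def by blast
  obtain x where x: "x \<in> C" "primitive_chain R G E x" "chain_support R E x = X"
    using primitive_rep[OF P C el(1)] el by blast
  obtain y where y: "y \<in> C" "primitive_chain R G E y" "chain_support R E y = Y"
    using primitive_rep[OF P C el(3)] el by blast
  have "\<not> X \<subset> Y" using el unfolding elementary_chain_def by blast
  then obtain f where f: "f \<in> X" "f \<notin> Y" using XY by blast
  have eE: "e \<in> E" "f \<in> E" using e f el by (auto simp: chain_support_def)
  have u: "x e \<in> Units R" "y e \<in> Units R" "x f \<in> Units R" "x f \<noteq> \<zero>" "y f = \<zero>"
    using e f x y GU eE unfolding primitive_chain_def chain_support_def by auto
  define d where "d = add_chain R E (scale_chain R E (inv (x e)) x)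
    (scale_chain R E (\<ominus> (inv (y e))) y)"
  have dC: "d \<in> C" using cg x y u unfolding chain_group_def d_def by auto
  have fn: "x \<in> E \<rightarrow>\<^sub>E carrier R" "y \<in> E \<rightarrow>\<^sub>E carrier R"
    using x y cg unfolding chain_group_def by auto
  have dv: "d i = inv (x e) \<otimes> x i \<oplus> \<ominus> (inv (y e)) \<otimes> y i" if "i \<in> E" for i
    using that by (simp add: d_def add_chain_def scale_chain_def)
  have de: "d e = \<zero>" using u eE by (simp add: dv l_minus Units_closed r_neg)
  have "d f = inv (x e) \<otimes> x f" using u eE by (simp add: dv Units_closed)
  moreover have "inv (x e) \<otimes> x f \<noteq> \<zero>"
  proof
    assume "inv (x e) \<otimes> x f = \<zero>"
    then have "x e \<otimes> (inv (x e) \<otimes> x f) = \<zero>" using u by (simp add: Units_closed)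
    then show False using u by (simp add: m_assoc[symmetric] Units_closed)
  qed
  ultimately have "d \<noteq> zero_chain R E" using eE by (auto simp: zero_chain_def)
  then obtain z where z: "elementary_chain R E C z" "chain_support R E z \<subseteq> chain_support R E d"
    using elementary_below[OF fin cg dC] by blast
  have "d i = \<zero>" if "i \<in> E" "x i = \<zero>" "y i = \<zero>" for i
    using that u by (simp add: dv)
  then have "chain_support R E d \<subseteq> (X \<union> Y) - {e}"
    using de x(3) y(3) unfolding chain_support_def by auto
  then show ?thesis using z unfolding elementary_supports_def by blast
qed

lemma chain_matroid_unique:
  assumes fin: "finite E" and P: "skew_partial_field R G" and C: "pf_chain_group R G E C"
  shows "\<exists>!M. is_matroid M \<and> ground M = E \<and> cocircuits M = elementary_supports R E C"
proof -
  let ?D = "elementary_supports R E C"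
  have "?D \<subseteq> Pow E" by (auto simp: elementary_supports_def chain_support_def)
  moreover have "{} \<notin> ?D"
  proof
    assume "{} \<in> ?D"
    then obtain c where c: "elementary_chain R E C c" "chain_support R E c = {}"
      by (auto simp: elementary_supports_def)
    then have "c \<in> E \<rightarrow>\<^sub>E carrier R" "c \<noteq> zero_chain R E"
      using C unfolding pf_chain_group_def chain_group_def elementary_chain_def by auto
    then show False using c support_empty_iff by blast
  qed
  moreover have "X = Y" if "X \<in> ?D" "Y \<in> ?D" "X \<subseteq> Y" for X Y
    using that unfolding elementary_supports_def elementary_chain_def by blast
  ultimately have "\<exists>N. is_matroid N \<and> ground N = E \<and> circuits N = ?D"
    by (rule matroid_of_circuits[OF fin]) (assumption | rule elementary_supports_elim[OF fin P C])+
  then obtain N where N: "is_matroid N" "ground N = E" "circuits N = ?D" by blast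
  let ?M = "dual_matroid N"
  have "is_matroid ?M \<and> ground ?M = E \<and> cocircuits ?M = ?D"
    using N by (simp add: is_matroid_dual cocircuits_def dual_dual_matroid)
  then show ?thesis using matroid_eqI_cocircuits by metis
qed

end

theory Submission
  imports Defs
begin

text \<open>
  A basis \<open>B\<close> of \<open>M(C)\<close> puts \<open>C\<close> in standard form: the fundamental cocircuits of \<open>B\<close> carry
  primitive chains \<open>a b\<close> (\<open>b \<in> B\<close>) that restrict to unit vectors on \<open>B\<close>, and every chain \<open>c\<close> of
  \<open>C\<close> equals \<open>\<Sum>b\<in>B. c b \<cdot> a b\<close>, because a chain vanishing on \<open>B\<close> is zero. Transposing, each
  \<open>y \<notin> B\<close> yields the primitive chain of the orthogonal group that is 1 at \<open>y\<close> and \<open>- a b y\<close> at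
  \<open>b \<in> B\<close>. These cochains force \<open>C\<^sup>\<bottom>\<^sup>\<bottom> \<subseteq> C\<close>; moreover the supports of nonzero cochains are dependent
  in \<open>M(C)\<close>, and by basis exchange every circuit of \<open>M(C)\<close> is the support of such a cochain.
  Hence the circuits of \<open>M(C)\<close> are the elementary supports of \<open>C\<^sup>\<bottom>\<close>.
\<close>

section \<open>The opposite ring, and preliminaries on matroids and chain groups\<close>

text \<open>Only the multiplication changes; finite sums live in the additive monoid, which both
  rings share.\<close>

lemma opposite_ring_simps [simp]:
  "carrier (opposite_ring R) = carrier R"
  "\<zero>\<^bsub>opposite_ring R\<^esub> = \<zero>\<^bsub>R\<^esub>"
  "x \<oplus>\<^bsub>opposite_ring R\<^esub> y = x \<oplus>\<^bsub>R\<^esub> y"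
  "x \<otimes>\<^bsub>opposite_ring R\<^esub> y = y \<otimes>\<^bsub>R\<^esub> x"
  "finsum (opposite_ring R) f A = finsum R f A"
  by (simp_all add: opposite_ring_def finsum_def)

lemma chain_opposite_simps [simp]:
  "zero_chain (opposite_ring R) E = zero_chain R E"
  "add_chain (opposite_ring R) E = add_chain R E"
  "chain_support (opposite_ring R) E = chain_support R E"
  by (simp_all add: fun_eq_iff zero_chain_def add_chain_def chain_support_def)

text \<open>A basis containing \<open>I\<close> has at most \<open>card B\<close> elements, so it is
  \<open>I\<close> itself. In \<open>basis_exchange\<close> this is applied to the dual
  matroid.\<close>

lemma basis_of_card:
  assumes M: "is_matroid M" and I: "I \<in> indeps M" and B: "B \<in> bases M" and "card I = card B"
  shows "I \<in> bases M"
proof -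
  obtain B' where B': "B' \<in> bases M" "I \<subseteq> B'" using I indeps_iff[OF M] by blast
  then have "B' \<in> indeps M" by (simp add: bases_def)
  then have "finite B'" "card B' \<le> card I"
    using matroid_indepD(2)[OF M] bases_card_le[OF M _ B] assms(4) by auto
  then show ?thesis using B' card_seteq by metis
qed

context ring
begin

lemma diff_eq_zeroD: "x \<ominus> y = \<zero> \<Longrightarrow> x \<in> carrier R \<Longrightarrow> y \<in> carrier R \<Longrightarrow> x = y"
  using minus_equality[of x "\<ominus> y"] by (simp add: minus_eq)

lemma chain_group_sum:
  assumes C: "chain_group R E C" and "finite S" "\<And>b. b \<in> S \<Longrightarrow> f b \<in> C"
  shows "(\<lambda>e\<in>E. \<Oplus>b\<in>S. f b e) \<in> C"
  using assms(2,3)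
proof (induction S rule: finite_induct)
  case empty
  have "(\<lambda>e\<in>E. \<Oplus>b\<in>{}. f b e) = zero_chain R E" by (simp add: zero_chain_def)
  then show ?case using C by (simp only: chain_group_def)
next
  case (insert b S)
  have fn: "f i e \<in> carrier R" if "i \<in> insert b S" "e \<in> E" for i e
    using C insert.prems[OF that(1)] that(2) unfolding chain_group_def by blast
  have "(\<lambda>e\<in>E. \<Oplus>i\<in>insert b S. f i e) = add_chain R E (f b) (\<lambda>e\<in>E. \<Oplus>i\<in>S. f i e)"
    unfolding add_chain_def by (rule restrict_ext) (simp add: insert.hyps fn finsum_insert)
  moreover have "f b \<in> C" "(\<lambda>e\<in>E. \<Oplus>i\<in>S. f i e) \<in> C" by (intro insert; simp add: insert)+
  ultimately show ?case using C unfolding chain_group_def by metis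
qed

lemma chain_group_perp:
  assumes fin: "finite E" and C: "C \<subseteq> E \<rightarrow>\<^sub>E carrier R"
  shows "chain_group (opposite_ring R) E (perp R E C)"
proof -
  have fn: "c e \<in> carrier R" if "c \<in> C" "e \<in> E" for c e using C that by blast
  have zero: "zero_chain R E \<in> perp R E C"
  proof -
    have "(\<Oplus>e\<in>E. c e \<otimes> zero_chain R E e) = \<zero>" if "c \<in> C" for c
      using fn[OF that] by (intro add.finprod_one_eqI) (simp add: zero_chain_def)
    then show ?thesis by (auto simp: perp_def zero_chain_def)
  qed
  have add: "add_chain R E d d' \<in> perp R E C" if d: "d \<in> perp R E C" "d' \<in> perp R E C" for d d'
  proof -
    have dn: "d e \<in> carrier R" "d' e \<in> carrier R" if "e \<in> E" for e
      using d that by (auto simp: perp_def)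
    have "(\<Oplus>e\<in>E. c e \<otimes> add_chain R E d d' e) = \<zero>" if c: "c \<in> C" for c
    proof -
      have "(\<Oplus>e\<in>E. c e \<otimes> add_chain R E d d' e) = (\<Oplus>e\<in>E. c e \<otimes> d e \<oplus> c e \<otimes> d' e)"
        by (rule finsum_cong') (auto simp: add_chain_def r_distr fn[OF c] dn)
      also have "\<dots> = (\<Oplus>e\<in>E. c e \<otimes> d e) \<oplus> (\<Oplus>e\<in>E. c e \<otimes> d' e)"
        by (rule finsum_addf) (auto simp: fn[OF c] dn)
      also have "\<dots> = \<zero>" using d c by (simp add: perp_def)
      finally show ?thesis .
    qed
    then show ?thesis using dn by (auto simp: perp_def add_chain_def)
  qed
  \<comment> \<open>Scaling over the opposite ring multiplies entries by \<open>r\<close> on the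
    right, so \<open>r\<close> can be pulled out of the pairing sum on the right.\<close>
  have scale: "scale_chain (opposite_ring R) E r d \<in> perp R E C"
    if r: "r \<in> carrier R" and d: "d \<in> perp R E C" for r d
  proof -
    have dn: "d e \<in> carrier R" if "e \<in> E" for e using d that by (auto simp: perp_def)
    have "(\<Oplus>e\<in>E. c e \<otimes> scale_chain (opposite_ring R) E r d e) = \<zero>" if c: "c \<in> C" for c
    proof -
      have "(\<Oplus>e\<in>E. c e \<otimes> scale_chain (opposite_ring R) E r d e) = (\<Oplus>e\<in>E. c e \<otimes> d e \<otimes> r)"
        by (rule finsum_cong') (auto simp: scale_chain_def m_assoc fn[OF c] dn r)
      also have "\<dots> = (\<Oplus>e\<in>E. c e \<otimes> d e) \<otimes> r"
        by (rule finsum_ldistr[symmetric]) (auto simp: fn[OF c] dn r fin)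
      also have "\<dots> = \<zero>" using d c r by (simp add: perp_def)
      finally show ?thesis .
    qed
    then show ?thesis using dn r by (auto simp: perp_def scale_chain_def)
  qed
  have "perp R E C \<subseteq> E \<rightarrow>\<^sub>E carrier R" by (auto simp: perp_def)
  then show ?thesis using zero add scale by (simp add: chain_group_def)
qed

end

section \<open>The matroid of a chain group over a skew partial field\<close>

locale pf_chains = ring R for R (structure) +
  fixes G :: "'a set" and E :: "'e set" and C :: "('e \<Rightarrow> 'a) set"
  assumes spf: "skew_partial_field R G" and fin: "finite E" and pf: "pf_chain_group R G E C"
begin

abbreviation M where "M \<equiv> chain_matroid R E C"

lemma M: "is_matroid M" "ground M = E" "circuits (dual_matroid M) = elementary_supports R E C"
  using theI'[OF chain_matroid_unique[OF fin spf pf]]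
  unfolding chain_matroid_def[symmetric] by (simp_all add: cocircuits_def)

lemma cg: "chain_group R E C"
  using pf by (simp add: pf_chain_group_def)

lemma chain_closed: "c \<in> C \<Longrightarrow> e \<in> E \<Longrightarrow> c e \<in> carrier R"
  using cg unfolding chain_group_def by blast

lemma G_Units: "G \<subseteq> Units R"
  using spf subgroup.subset unfolding skew_partial_field_def by (metis units_of_carrier)

text \<open>Negation is multiplication by -1, an element of \<open>G\<close>; it keeps the negated
  entries of cochains primitive.\<close>

lemma G_closed: "g \<in> G \<Longrightarrow> h \<in> G \<Longrightarrow> g \<otimes> h \<in> G" "g \<in> G \<Longrightarrow> inv g \<in> G" "g \<in> G \<Longrightarrow> \<ominus> g \<in> G" "\<one> \<in> G"
proof -
  have sg: "subgroup G (units_of R)" and m1: "\<ominus> \<one> \<in> G"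
    using spf by (auto simp: skew_partial_field_def)
  show mult: "g \<otimes> h \<in> G" if "g \<in> G" "h \<in> G" for g h
    using subgroup.m_closed[OF sg that] by (simp add: units_of_mult)
  show "inv g \<in> G" if "g \<in> G"
    using subgroup.m_inv_closed[OF sg that] that G_Units units_of_inv by auto
  show "\<ominus> g \<in> G" if "g \<in> G"
    using mult[OF m1 that] that G_Units by (auto simp: l_minus Units_closed)
  show "\<one> \<in> G" using subgroup.one_closed[OF sg] by (simp add: units_of_one)
qed

lemma one_not_zero: "\<one> \<noteq> \<zero>"
  using spf by (simp add: skew_partial_field_def)

lemma indeps_dual_iff:
  "I \<in> indeps (dual_matroid M) \<longleftrightarrow> I \<subseteq> E \<and> (\<forall>X\<in>elementary_supports R E C. \<not> X \<subseteq> I)"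
  using indeps_circuits[OF is_matroid_dual[OF M(1)]] M(2,3) by auto

lemma basis_complement: "B \<in> bases M \<Longrightarrow> E - B \<in> bases (dual_matroid M)"
  using bases_dual[OF M(1)] M(2) by simp

lemma basis_sub: "B \<in> bases M \<Longrightarrow> B \<subseteq> E"
  using bases_subset[OF M(1)] M(2) by simp

section \<open>Standard form of \<open>C\<close> with respect to a basis\<close>

text \<open>Otherwise the support contains a cocircuit disjoint from \<open>B\<close>, but
  \<open>E - B\<close> is independent in the dual matroid and contains no cocircuit.\<close>

lemma zero_if_vanishes_on_basis:
  assumes B: "B \<in> bases M" and c: "c \<in> C" "\<And>b. b \<in> B \<Longrightarrow> c b = \<zero>"
  shows "c = zero_chain R E"
proof (rule ccontr)
  assume "c \<noteq> zero_chain R E"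
  then obtain d where "elementary_chain R E C d" "chain_support R E d \<subseteq> chain_support R E c"
    using elementary_below[OF fin cg c(1)] by blast
  moreover have "chain_support R E c \<subseteq> E - B" using c(2) by (auto simp: chain_support_def)
  ultimately have "E - B \<notin> indeps (dual_matroid M)"
    unfolding indeps_dual_iff elementary_supports_def by blast
  then show False using basis_complement[OF B] by (simp add: bases_def)
qed

text \<open>Adding \<open>b\<close> to the cobasis \<open>E - B\<close> creates a cocircuit through
  \<open>b\<close> that meets \<open>B\<close> only in \<open>b\<close>. A primitive chain on it has
  a unit at \<open>b\<close>, and multiplying by its inverse on the left makes that entry 1.\<close>

lemma fundamental_chain_exists:
  assumes B: "B \<in> bases M" and b: "b \<in> B"
  shows "\<exists>a\<in>C. a b = \<one> \<and> (\<forall>b'\<in>B - {b}. a b' = \<zero>) \<and> primitive_chain R G E a"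
proof -
  have EB: "E - B \<in> indeps (dual_matroid M)"
      "\<And>I. I \<in> indeps (dual_matroid M) \<Longrightarrow> E - B \<subseteq> I \<Longrightarrow> I = E - B"
    using basis_complement[OF B] by (auto simp: bases_def)
  have bE: "b \<in> E" using B b basis_sub by blast
  have "insert b (E - B) \<notin> indeps (dual_matroid M)" using EB(2)[of "insert b (E - B)"] b by blast
  then obtain X where X: "X \<in> elementary_supports R E C" "X \<subseteq> insert b (E - B)"
    using bE unfolding indeps_dual_iff by blast
  have bX: "b \<in> X" using X EB(1) unfolding indeps_dual_iff by blast
  obtain c where c: "c \<in> C" "primitive_chain R G E c" "chain_support R E c = X"
    using X(1) primitive_rep[OF spf pf] unfolding elementary_supports_def by blast
  have cb: "c b \<in> G" using c bX bE unfolding primitive_chain_def chain_support_def by auto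
  then have cu: "c b \<in> Units R" using G_Units by blast
  let ?a = "scale_chain R E (inv (c b)) c"
  have "?a \<in> C" using cg c(1) cu unfolding chain_group_def by auto
  moreover have "?a b = \<one>" using bE cu by (simp add: scale_chain_def)
  moreover have "?a b' = \<zero>" if "b' \<in> B - {b}" for b'
  proof -
    have "b' \<in> E" "b' \<notin> X" using that basis_sub[OF B] X(2) by auto
    then have "c b' = \<zero>" using c(3) by (auto simp: chain_support_def)
    then show ?thesis using \<open>b' \<in> E\<close> cu by (simp add: scale_chain_def)
  qed
  moreover have "primitive_chain R G E ?a"
    unfolding primitive_chain_def
  proof
    fix e assume e: "e \<in> E"
    then have "c e \<in> G \<union> {\<zero>}" using c(2) by (simp add: primitive_chain_def)
    then show "?a e \<in> G \<union> {\<zero>}" using e cb cu G_closed by (auto simp: scale_chain_def)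
  qed
  ultimately show ?thesis by blast
qed

text \<open>For a basis \<open>B\<close> and \<open>b\<close> in \<open>B\<close> the choice is
  harmless: two candidates agree on \<open>B\<close>, so their difference is zero by
  \<open>zero_if_vanishes_on_basis\<close>.\<close>

definition fundamental_chain :: "'e set \<Rightarrow> 'e \<Rightarrow> 'e \<Rightarrow> 'a" where
  "fundamental_chain B b =
     (SOME a. a \<in> C \<and> a b = \<one> \<and> (\<forall>b'\<in>B - {b}. a b' = \<zero>) \<and> primitive_chain R G E a)"

lemma fundamental_chain:
  assumes "B \<in> bases M" "b \<in> B"
  shows "fundamental_chain B b \<in> C" "fundamental_chain B b b = \<one>"
    "b' \<in> B \<Longrightarrow> b' \<noteq> b \<Longrightarrow> fundamental_chain B b b' = \<zero>"
    "primitive_chain R G E (fundamental_chain B b)"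
proof -
  let ?P = "\<lambda>a. a \<in> C \<and> a b = \<one> \<and> (\<forall>b'\<in>B - {b}. a b' = \<zero>) \<and> primitive_chain R G E a"
  have "?P (fundamental_chain B b)"
    unfolding fundamental_chain_def
    by (rule someI_ex[of ?P]) (use fundamental_chain_exists[OF assms] in blast)
  then show "fundamental_chain B b \<in> C" "fundamental_chain B b b = \<one>"
    "b' \<in> B \<Longrightarrow> b' \<noteq> b \<Longrightarrow> fundamental_chain B b b' = \<zero>"
    "primitive_chain R G E (fundamental_chain B b)" by auto
qed

lemma fundamental_chain_carrier:
  "B \<in> bases M \<Longrightarrow> b \<in> B \<Longrightarrow> e \<in> E \<Longrightarrow> fundamental_chain B b e \<in> carrier R"
  using fundamental_chain(1) chain_closed by blast

lemma combination_in_C: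
  assumes B: "B \<in> bases M" and s: "\<And>b. b \<in> B \<Longrightarrow> s b \<in> carrier R"
  shows "(\<lambda>e\<in>E. \<Oplus>b\<in>B. s b \<otimes> fundamental_chain B b e) \<in> C"
proof -
  have "(\<lambda>e\<in>E. \<Oplus>b\<in>B. s b \<otimes> fundamental_chain B b e)
      = (\<lambda>e\<in>E. \<Oplus>b\<in>B. scale_chain R E (s b) (fundamental_chain B b) e)"
    by (rule restrict_ext, rule finsum_cong')
      (auto simp: scale_chain_def s fundamental_chain_carrier[OF B])
  also have "\<dots> \<in> C"
    using cg fundamental_chain(1)[OF B] s finite_subset[OF basis_sub[OF B] fin]
    by (intro chain_group_sum) (auto simp: chain_group_def)
  finally show ?thesis .
qed

lemma combination_on_basis:
  assumes B: "B \<in> bases M" and s: "\<And>b. b \<in> B \<Longrightarrow> s b \<in> carrier R" and b: "b \<in> B"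
  shows "(\<Oplus>b'\<in>B. s b' \<otimes> fundamental_chain B b' b) = s b"
proof -
  have "(\<Oplus>b'\<in>B. s b' \<otimes> fundamental_chain B b' b) = (\<Oplus>b'\<in>B. if b = b' then s b' else \<zero>)"
    by (rule finsum_cong') (auto simp: s b fundamental_chain[OF B])
  also have "\<dots> = s b"
    by (rule add.finprod_singleton) (auto simp: s b finite_subset[OF basis_sub[OF B] fin])
  finally show ?thesis .
qed

text \<open>The two sides agree on \<open>B\<close> by \<open>combination_on_basis\<close>, so their
  difference is a chain of \<open>C\<close> vanishing on \<open>B\<close>.\<close>

lemma chain_expansion:
  assumes B: "B \<in> bases M" and c: "c \<in> C" and e: "e \<in> E"
  shows "c e = (\<Oplus>b\<in>B. c b \<otimes> fundamental_chain B b e)"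
proof -
  let ?l = "\<lambda>e\<in>E. \<Oplus>b\<in>B. c b \<otimes> fundamental_chain B b e"
  let ?d = "add_chain R E c (scale_chain R E (\<ominus> \<one>) ?l)"
  have s: "c b \<in> carrier R" if "b \<in> B" for b
    using that chain_closed[OF c] basis_sub[OF B] by blast
  have lC: "?l \<in> C" using combination_in_C[OF B s] .
  have dC: "?d \<in> C" using lC cg c by (simp add: chain_group_def)
  have de: "?d x = c x \<ominus> ?l x" if "x \<in> E" for x
    using that chain_closed[OF lC that] chain_closed[OF c that]
    by (simp add: add_chain_def scale_chain_def l_minus minus_eq)
  have "?d b = \<zero>" if b: "b \<in> B" for b
  proof -
    have bE: "b \<in> E" using b basis_sub[OF B] by blast
    then have "?l b = c b" using combination_on_basis[OF B s b] by simp
    then show ?thesis using de[OF bE] s[OF b] by (simp add: r_neg minus_eq)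
  qed
  then have "?d = zero_chain R E" by (rule zero_if_vanishes_on_basis[OF B dC])
  then have "c e \<ominus> ?l e = \<zero>" using de[OF e] e by (simp add: zero_chain_def)
  then have "c e = ?l e" using chain_closed[OF lC e] chain_closed[OF c e] diff_eq_zeroD by simp
  then show ?thesis using e by simp
qed

section \<open>Cochains of a basis and the double orthogonal\<close>

text \<open>If the fundamental chains are the rows of a matrix \<open>[I A]\<close>, with
  \<open>I\<close> on the columns in \<open>B\<close>, then for \<open>y\<close> outside
  \<open>B\<close> this is row \<open>y\<close> of the matrix \<open>[-A^T I]\<close>.\<close>

definition cochain :: "'e set \<Rightarrow> 'e \<Rightarrow> 'e \<Rightarrow> 'a" where
  "cochain B y = (\<lambda>e\<in>E. if e = y then \<one> else if e \<in> B then \<ominus> fundamental_chain B e y else \<zero>)"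

lemma cochain_carrier:
  "B \<in> bases M \<Longrightarrow> y \<in> E \<Longrightarrow> e \<in> E \<Longrightarrow> cochain B y e \<in> carrier R"
  by (simp add: cochain_def fundamental_chain_carrier)

text \<open>Here \<open>x\<close> need not lie in \<open>C\<close>: the formula serves chains of
  \<open>C\<close> in \<open>cochain_perp\<close> and members of the double orthogonal in
  \<open>perp_perp\<close>.\<close>

lemma cochain_pairing:
  assumes B: "B \<in> bases M" and y: "y \<in> E - B" and x: "\<And>e. e \<in> E \<Longrightarrow> x e \<in> carrier R"
  shows "(\<Oplus>e\<in>E. x e \<otimes> cochain B y e) = x y \<ominus> (\<Oplus>b\<in>B. x b \<otimes> fundamental_chain B b y)"
proof -
  have BE: "B \<subseteq> E" using basis_sub[OF B] .
  have xB: "x b \<in> carrier R" if "b \<in> B" for b using that BE x by blast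
  have fB: "finite B" using BE fin finite_subset by blast
  have yE: "y \<in> E" "y \<notin> B" using y by auto
  note ac = fundamental_chain_carrier[OF B _ yE(1)]
  have "(\<Oplus>e\<in>E. x e \<otimes> cochain B y e) = (\<Oplus>e\<in>insert y B. x e \<otimes> cochain B y e)"
    by (rule add.finprod_mono_neutral_cong_left[symmetric])
      (use BE yE fin x cochain_carrier[OF B yE(1)] in \<open>auto simp: cochain_def\<close>)
  also have "\<dots> = x y \<otimes> cochain B y y \<oplus> (\<Oplus>b\<in>B. x b \<otimes> cochain B y b)"
    by (rule finsum_insert) (use BE yE fB xB x cochain_carrier[OF B yE(1)] in auto)
  also have "x y \<otimes> cochain B y y = x y" using yE x by (simp add: cochain_def)
  \<comment> \<open>The sign is written as a left factor -1 so that distributivity moves it out of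
    the sum.\<close>
  also have "(\<Oplus>b\<in>B. x b \<otimes> cochain B y b) = (\<Oplus>b\<in>B. \<ominus> \<one> \<otimes> (x b \<otimes> fundamental_chain B b y))"
    by (rule finsum_cong') (use BE yE xB ac in \<open>auto simp: cochain_def l_minus r_minus\<close>)
  also have "\<dots> = \<ominus> \<one> \<otimes> (\<Oplus>b\<in>B. x b \<otimes> fundamental_chain B b y)"
    by (rule finsum_rdistr[symmetric]) (use fB xB ac in auto)
  also have "\<dots> = \<ominus> (\<Oplus>b\<in>B. x b \<otimes> fundamental_chain B b y)"
    by (subst l_minus) (use xB ac in auto)
  finally show ?thesis by (simp add: minus_eq)
qed

text \<open>The pairing is the difference of the two sides of \<open>chain_expansion\<close> at
  \<open>y\<close>.\<close>

lemma cochain_perp: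
  assumes B: "B \<in> bases M" and y: "y \<in> E - B"
  shows "cochain B y \<in> perp R E C"
proof -
  have "(\<Oplus>e\<in>E. c e \<otimes> cochain B y e) = \<zero>" if c: "c \<in> C" for c
    using cochain_pairing[OF B y chain_closed[OF c]] chain_expansion[OF B c] y chain_closed[OF c, of y]
    by (simp add: minus_eq r_neg)
  moreover have "cochain B y \<in> E \<rightarrow>\<^sub>E carrier R"
    using cochain_carrier[OF B] y by (auto simp: cochain_def)
  ultimately show ?thesis by (simp add: perp_def)
qed

text \<open>Orthogonality of \<open>x\<close> to all cochains of one basis says that the entries of
  \<open>x\<close> outside \<open>B\<close> arise from those on \<open>B\<close> as in
  \<open>chain_expansion\<close>; hence \<open>x\<close> is a combination of fundamental
  chains.\<close>

theorem perp_perp: "perp (opposite_ring R) E (perp R E C) = C"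
proof
  show "C \<subseteq> perp (opposite_ring R) E (perp R E C)"
    using cg by (auto simp: chain_group_def perp_def)
next
  show "perp (opposite_ring R) E (perp R E C) \<subseteq> C"
  proof
    fix x assume x: "x \<in> perp (opposite_ring R) E (perp R E C)"
    obtain B where B: "B \<in> bases M" using bases_ne[OF M(1)] by blast
    have xE: "x \<in> E \<rightarrow>\<^sub>E carrier R" using x by (simp add: perp_def)
    then have xc: "x e \<in> carrier R" if "e \<in> E" for e using that by blast
    have xB: "x b \<in> carrier R" if "b \<in> B" for b using that basis_sub[OF B] xc by blast
    have "x e = (\<Oplus>b\<in>B. x b \<otimes> fundamental_chain B b e)" if e: "e \<in> E" for e
    proof (cases "e \<in> B")
      case True
      then show ?thesis using combination_on_basis[OF B xB] by simp
    next
      case False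
      then have y: "e \<in> E - B" using e by simp
      \<comment> \<open>The outer orthogonal is formed in the opposite ring, which puts the entries
        of \<open>x\<close> on the left in \<open>R\<close>, as \<open>cochain_pairing\<close>
        requires.\<close>
      have "x e \<ominus> (\<Oplus>b\<in>B. x b \<otimes> fundamental_chain B b e) = \<zero>"
        using x cochain_perp[OF B y] cochain_pairing[OF B y, of x] xc
        by (simp add: perp_def[of "opposite_ring R"])
      moreover have "(\<Oplus>b\<in>B. x b \<otimes> fundamental_chain B b e) \<in> carrier R"
        using xB fundamental_chain_carrier[OF B _ e] by (intro finsum_closed) auto
      ultimately show ?thesis using xc[OF e] diff_eq_zeroD by simp
    qed
    then have "x = (\<lambda>e\<in>E. \<Oplus>b\<in>B. x b \<otimes> fundamental_chain B b e)"
      using PiE_arb[OF xE] by (auto simp: fun_eq_iff)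
    then show "x \<in> C" using combination_in_C[OF B, of x] xB by simp
  qed
qed

section \<open>Circuits of the matroid as supports of orthogonal chains\<close>

text \<open>If the support lay in a basis \<open>B\<close>, then pairing \<open>d\<close> with the
  fundamental chain of \<open>b\<close> would leave only the term \<open>d b\<close>, so
  \<open>d\<close> would vanish on \<open>B\<close> and hence everywhere.\<close>

lemma perp_support_dependent:
  assumes d: "d \<in> perp R E C" "d \<noteq> zero_chain R E"
  shows "chain_support R E d \<notin> indeps M"
proof
  assume "chain_support R E d \<in> indeps M"
  then obtain B where B: "B \<in> bases M" "chain_support R E d \<subseteq> B"
    using indeps_iff[OF M(1)] by blast
  have dE: "d \<in> E \<rightarrow>\<^sub>E carrier R" using d by (simp add: perp_def)
  have "d b = \<zero>" if b: "b \<in> B" for b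
  proof -
    let ?a = "fundamental_chain B b"
    have bE: "b \<in> E" using b B basis_sub by blast
    have d0: "d e = \<zero>" if "e \<in> E" "e \<notin> B" for e using that B by (auto simp: chain_support_def)
    have "\<zero> = (\<Oplus>e\<in>E. ?a e \<otimes> d e)"
      using d fundamental_chain(1)[OF B(1) b] by (simp add: perp_def)
    also have "\<dots> = (\<Oplus>e\<in>E. if b = e then d e else \<zero>)"
    proof (rule finsum_cong')
      fix e assume e: "e \<in> E"
      show "?a e \<otimes> d e = (if b = e then d e else \<zero>)"
      proof (cases "e \<in> B")
        case True
        then show ?thesis
          using fundamental_chain(2,3)[OF B(1) b] PiE_mem[OF dE e] by auto
      next
        case False
        then show ?thesis
          using d0[OF e] b fundamental_chain_carrier[OF B(1) b e] by auto
      qed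
    qed (use dE in auto)
    also have "\<dots> = d b" by (rule add.finprod_singleton) (use dE fin bE in auto)
    finally show ?thesis by simp
  qed
  then have "chain_support R E d = {}" using B(2) by (auto simp: chain_support_def)
  then show False using support_empty_iff[OF dE] d(2) by simp
qed

text \<open>A chain vanishing on the new set has, by \<open>chain_expansion\<close>, the value
  \<open>c b\<close> times a unit at \<open>y\<close>. So \<open>c b\<close> is zero, the chain
  vanishes on \<open>B\<close>, and it is zero. Thus the complement of the new set contains no
  cocircuit and has the size of a cobasis.\<close>

lemma basis_exchange:
  assumes B: "B \<in> bases M" and b: "b \<in> B" and y: "y \<in> E - B" and nz: "fundamental_chain B b y \<noteq> \<zero>"
  shows "insert y (B - {b}) \<in> bases M"
proof -
  let ?B = "insert y (B - {b})"
  have BE: "B \<subseteq> E" using basis_sub[OF B] .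
  have finB: "finite B" using BE fin finite_subset by blast
  have u: "fundamental_chain B b y \<in> Units R"
    using fundamental_chain(4)[OF B b] y nz G_Units unfolding primitive_chain_def by blast
  have "\<not> X \<subseteq> E - ?B" if X: "X \<in> elementary_supports R E C" for X
  proof
    assume sub: "X \<subseteq> E - ?B"
    obtain c where c: "elementary_chain R E C c" "X = chain_support R E c"
      using X unfolding elementary_supports_def by blast
    then have cC: "c \<in> C" "c \<noteq> zero_chain R E" by (auto simp: elementary_chain_def)
    have c0: "c e = \<zero>" if "e \<in> ?B" for e
      using that sub c(2) y BE by (auto simp: chain_support_def)
    have cb: "c b \<in> carrier R" using chain_closed[OF cC(1)] BE b by blast
    have "c y = (\<Oplus>b'\<in>B. c b' \<otimes> fundamental_chain B b' y)"
      using chain_expansion[OF B cC(1)] y by blast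
    also have "\<dots> = (\<Oplus>b'\<in>B. if b = b' then c b' \<otimes> fundamental_chain B b' y else \<zero>)"
      using c0 cb b fundamental_chain_carrier[OF B] y by (intro finsum_cong') auto
    also have "\<dots> = c b \<otimes> fundamental_chain B b y"
      by (rule add.finprod_singleton)
        (use b finB BE chain_closed[OF cC(1)] fundamental_chain_carrier[OF B] y in auto)
    finally have "c b \<otimes> fundamental_chain B b y = \<zero>" using c0[of y] by simp
    then have "c b \<otimes> fundamental_chain B b y \<otimes> inv (fundamental_chain B b y) = \<zero>"
      using u by simp
    then have "c b = \<zero>" using u cb by (simp add: m_assoc Units_closed)
    then have "c e = \<zero>" if "e \<in> B" for e using c0 that by blast
    then show False using zero_if_vanishes_on_basis[OF B cC(1)] cC(2) by blast
  qed
  then have "E - ?B \<in> indeps (dual_matroid M)" unfolding indeps_dual_iff by blast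
  moreover have "card ?B = card B"
    using b y finB card_Suc_Diff1[OF finB b] by simp
  moreover have "card (E - ?B) = card E - card ?B" "card (E - B) = card E - card B"
    by (rule card_Diff_subset; use BE y finB in blast)+
  ultimately have "E - ?B \<in> bases (dual_matroid M)"
    using basis_of_card[OF is_matroid_dual[OF M(1)] _ basis_complement[OF B]] by metis
  \<comment> \<open>Complements of bases of the dual are bases of the double dual, which is
    \<open>M\<close>.\<close>
  then have "E - (E - ?B) \<in> bases M"
    using bases_dual[OF is_matroid_dual[OF M(1)]] dual_dual_matroid[OF M(1)] M(2) by auto
  moreover have "E - (E - ?B) = ?B" using BE y by blast
  ultimately show ?thesis by simp
qed

text \<open>The set \<open>Y\<close> without one element \<open>y\<close> extends to a basis
  \<open>B\<close>, and \<open>cochain B y\<close> is the required chain: its support is dependent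
  and contained in \<open>Y\<close>, so minimality of the circuit gives equality.\<close>

lemma circuit_cochain:
  assumes Y: "Y \<in> circuits M"
  shows "\<exists>d\<in>perp R E C. primitive_chain R G E d \<and> chain_support R E d = Y"
proof -
  have YE: "Y \<subseteq> E" "Y \<notin> indeps M" "\<And>X. X \<subset> Y \<Longrightarrow> X \<in> indeps M"
    using Y M(2) by (auto simp: circuits_def)
  have "{} \<in> indeps M" using M(1) by (simp add: is_matroid_def)
  then obtain y where y: "y \<in> Y" using YE(2) by fastforce
  then have "Y - {y} \<in> indeps M" by (intro YE(3)) auto
  then obtain B where B: "B \<in> bases M" "Y - {y} \<subseteq> B" using indeps_iff[OF M(1)] by blast
  have noB: "\<not> Y \<subseteq> B'" if "B' \<in> bases M" for B' using that indeps_iff[OF M(1)] YE(2) by blast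
  then have yB: "y \<in> E - B" using B y YE(1) by blast
  have sub: "chain_support R E (cochain B y) \<subseteq> Y"
  proof
    fix e assume "e \<in> chain_support R E (cochain B y)"
    then have e: "e \<in> E" "cochain B y e \<noteq> \<zero>" by (auto simp: chain_support_def)
    show "e \<in> Y"
    proof (rule ccontr)
      assume "e \<notin> Y"
      then have "e \<noteq> y" using y by blast
      then have "e \<in> B" "fundamental_chain B e y \<noteq> \<zero>"
        using e by (auto simp: cochain_def split: if_splits)
      \<comment> \<open>As \<open>e\<close> is not in \<open>Y\<close>, the exchanged basis would
        contain all of the dependent set \<open>Y\<close>.\<close>
      then have "insert y (B - {e}) \<in> bases M" using basis_exchange[OF B(1) _ yB] by blast
      then show False using noB B(2) \<open>e \<notin> Y\<close> by blast
    qed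
  qed
  have "cochain B y y \<noteq> zero_chain R E y"
    using yB one_not_zero by (simp add: cochain_def zero_chain_def)
  then have "chain_support R E (cochain B y) \<notin> indeps M"
    using perp_support_dependent[OF cochain_perp[OF B(1) yB]] by metis
  then have "chain_support R E (cochain B y) = Y" using sub YE(3) by blast
  moreover have "primitive_chain R G E (cochain B y)"
    unfolding primitive_chain_def
  proof
    fix e assume e: "e \<in> E"
    have "fundamental_chain B e y \<in> G \<union> {\<zero>}" if "e \<in> B"
      using fundamental_chain(4)[OF B(1) that] yB by (simp add: primitive_chain_def)
    then show "cochain B y e \<in> G \<union> {\<zero>}" using e G_closed by (auto simp: cochain_def)
  qed
  ultimately show ?thesis using cochain_perp[OF B(1) yB] by blast
qed

text \<open>The support is dependent, so it contains a circuit; this circuit carries a nonzero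
  orthogonal chain, and elementarity of \<open>d\<close> forbids proper inclusion.\<close>

lemma elementary_perp_circuit:
  assumes d: "elementary_chain (opposite_ring R) E (perp R E C) d"
  shows "chain_support R E d \<in> circuits M"
proof -
  have dp: "d \<in> perp R E C" "d \<noteq> zero_chain R E"
      "\<And>d'. d' \<in> perp R E C \<Longrightarrow> d' \<noteq> zero_chain R E \<Longrightarrow>
         \<not> chain_support R E d' \<subset> chain_support R E d"
    using d unfolding elementary_chain_def by auto
  have "chain_support R E d \<subseteq> ground M" using M(2) by (auto simp: chain_support_def)
  then obtain Y where Y: "Y \<in> circuits M" "Y \<subseteq> chain_support R E d"
    using perp_support_dependent[OF dp(1,2)] indeps_circuits[OF M(1)] by blast
  obtain d' where d': "d' \<in> perp R E C" "chain_support R E d' = Y"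
    using circuit_cochain[OF Y(1)] by blast
  have "Y \<noteq> {}" using Y(1) M(1) by (auto simp: circuits_def is_matroid_def)
  then have "d' \<noteq> zero_chain R E" using d'(2) by (auto simp: chain_support_def zero_chain_def)
  then have "Y = chain_support R E d" using dp(3)[OF d'(1)] d'(2) Y(2) by blast
  then show ?thesis using Y(1) by simp
qed

theorem circuits_eq_elementary_supports_perp:
  "circuits M = elementary_supports (opposite_ring R) E (perp R E C)"
proof
  show "elementary_supports (opposite_ring R) E (perp R E C) \<subseteq> circuits M"
    using elementary_perp_circuit by (auto simp: elementary_supports_def)
  show "circuits M \<subseteq> elementary_supports (opposite_ring R) E (perp R E C)"
  proof
    fix Y assume Y: "Y \<in> circuits M"
    obtain d where d: "d \<in> perp R E C" "chain_support R E d = Y"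
      using circuit_cochain[OF Y] by blast
    have "Y \<noteq> {}" using Y M(1) by (auto simp: circuits_def is_matroid_def)
    then have "d \<noteq> zero_chain R E" using d(2) by (auto simp: chain_support_def zero_chain_def)
    \<comment> \<open>Proper subsets of a circuit are independent, whereas nonzero orthogonal chains
      have dependent supports.\<close>
    moreover have "\<not> chain_support R E d' \<subset> Y" if "d' \<in> perp R E C" "d' \<noteq> zero_chain R E" for d'
      using perp_support_dependent[OF that] Y by (auto simp: circuits_def)
    ultimately have "elementary_chain (opposite_ring R) E (perp R E C) d"
      using d by (auto simp: elementary_chain_def)
    then show "Y \<in> elementary_supports (opposite_ring R) E (perp R E C)"
      using d(2) by (auto simp: elementary_supports_def)
  qed
qed

section \<open>The orthogonal chain group and the dual matroid\<close>

text \<open>The support of an elementary \<open>d\<close> is a circuit, so it is also the support of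
  a primitive orthogonal chain \<open>d'\<close>. Cancelling one entry of \<open>d\<close> by a
  multiple of \<open>d'\<close> leaves a chain of strictly smaller support, which must be
  zero.\<close>

theorem pf_chain_group_perp:
  "pf_chain_group (opposite_ring R) (opposite_group R G) E (perp R E C)"
proof -
  have cgp: "chain_group (opposite_ring R) E (perp R E C)"
    using cg fin by (intro chain_group_perp) (auto simp: chain_group_def)
  have "\<exists>r\<in>carrier R. \<exists>d'\<in>perp R E C. primitive_chain (opposite_ring R) (opposite_group R G) E d'
          \<and> d = scale_chain (opposite_ring R) E r d'"
    if el: "elementary_chain (opposite_ring R) E (perp R E C) d" for d
  proof -
    have dp: "d \<in> perp R E C"
        "\<And>d'. d' \<in> perp R E C \<Longrightarrow> d' \<noteq> zero_chain R E \<Longrightarrow>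
           \<not> chain_support R E d' \<subset> chain_support R E d"
      using el unfolding elementary_chain_def by auto
    have Y: "chain_support R E d \<in> circuits M" using elementary_perp_circuit[OF el] .
    obtain d' where d': "d' \<in> perp R E C" "primitive_chain R G E d'"
        "chain_support R E d' = chain_support R E d"
      using circuit_cochain[OF Y] by blast
    have "chain_support R E d \<noteq> {}" using Y M(1) by (auto simp: circuits_def is_matroid_def)
    then obtain e where e: "e \<in> chain_support R E d" by blast
    then have eE: "e \<in> E" "d' e \<noteq> \<zero>" using d'(3) by (auto simp: chain_support_def)
    then have u: "d' e \<in> Units R" using d'(2) G_Units by (auto simp: primitive_chain_def)
    have fn: "d \<in> E \<rightarrow>\<^sub>E carrier R" "d' \<in> E \<rightarrow>\<^sub>E carrier R" using dp d' by (auto simp: perp_def)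
    then have dc: "d i \<in> carrier R" "d' i \<in> carrier R" if "i \<in> E" for i using that by auto
    \<comment> \<open>Scalars act on the right in \<open>R\<close>; this \<open>r\<close> solves
      \<open>d' e \<otimes> r = d e\<close>.\<close>
    define r where "r = inv (d' e) \<otimes> d e"
    have r: "r \<in> carrier R" using u dc eE by (simp add: r_def)
    define f where "f = add_chain R E d (scale_chain (opposite_ring R) E (\<ominus> r) d')"
    have fp: "f \<in> perp R E C" using cgp dp(1) d'(1) r by (simp add: chain_group_def f_def)
    have fv: "f i = d i \<ominus> d' i \<otimes> r" if "i \<in> E" for i
      using that dc r by (simp add: f_def add_chain_def scale_chain_def r_minus minus_eq)
    have "d' e \<otimes> r = d e" using u dc eE by (simp add: r_def m_assoc[symmetric] Units_closed)
    then have "f e = \<zero>" using fv[OF eE(1)] dc[OF eE(1)] by (simp add: minus_eq r_neg)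
    moreover have "f i = \<zero>" if "i \<in> E" "d i = \<zero>" for i
    proof -
      have "d' i = \<zero>" using d'(3) that by (auto simp: chain_support_def)
      then show ?thesis using fv[OF that(1)] that r by (simp add: minus_eq)
    qed
    ultimately have "chain_support R E f \<subset> chain_support R E d"
      using e by (auto simp: chain_support_def)
    then have "f = zero_chain R E" using dp(2)[OF fp] by blast
    then have "d i = d' i \<otimes> r" if "i \<in> E" for i
      using fv[OF that] that dc[OF that] r diff_eq_zeroD by (simp add: zero_chain_def)
    then have "d = scale_chain (opposite_ring R) E r d'"
      using PiE_arb[OF fn(1)] by (auto simp: fun_eq_iff scale_chain_def)
    moreover have "primitive_chain (opposite_ring R) (opposite_group R G) E d'"
      using d'(2) by (auto simp: primitive_chain_def opposite_group_def intro: generate.incl)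
    ultimately show ?thesis using r d'(1) by blast
  qed
  then show ?thesis using cgp by (simp add: pf_chain_group_def)
qed

text \<open>The cocircuits of the dual are the circuits of \<open>M\<close>, that is, the elementary
  supports of the orthogonal group. Since that group is a chain group over the opposite skew partial
  field, \<open>chain_matroid_unique\<close> identifies the two matroids.\<close>

theorem dual_chain_matroid: "dual_matroid M = chain_matroid (opposite_ring R) E (perp R E C)"
proof -
  have "is_matroid (dual_matroid M) \<and> ground (dual_matroid M) = E \<and>
      cocircuits (dual_matroid M) = elementary_supports (opposite_ring R) E (perp R E C)"
    using M(1,2) circuits_eq_elementary_supports_perp
    by (simp add: is_matroid_dual cocircuits_def dual_dual_matroid)
  from the1_equality[OF chain_matroid_unique[OF fin skew_partial_field_opposite[OF spf]
        pf_chain_group_perp] this]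
  show ?thesis unfolding chain_matroid_def[of "opposite_ring R"] by (rule sym)
qed

end

theorem theorem3p12:
  fixes R :: "('r, 'm) ring_scheme" and G :: "'r set" and E :: "'e set" and C :: "('e \<Rightarrow> 'r) set"
  assumes "skew_partial_field R G" and "finite E" and "pf_chain_group R G E C"
  shows "perp (opposite_ring R) E (perp R E C) = C \<and>
         pf_chain_group (opposite_ring R) (opposite_group R G) E (perp R E C) \<and>
         dual_matroid (chain_matroid R E C) = chain_matroid (opposite_ring R) E (perp R E C)"
proof -
  interpret ring R using assms(1) by (simp add: skew_partial_field_def)
  interpret pf_chains R G E C by unfold_locales (fact assms)+
  show ?thesis using perp_perp pf_chain_group_perp dual_chain_matroid by blast
qed

end
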